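(* Let $n=3$, and suppose that $\dim \mathcal{O}_{\mathcal{S}}=2$, $\dim\mathcal{B}=2$ and $v_0\notin\mathcal{O}_{\mathcal{S}}$. Assume that $\mathcal{O}_{\mathcal{S}}$ is not of the form $\mathrm{co}\{o_1,o_2,o_3\}$ with $o_i\in(v_0,v_i]$ for $i=1,2,3$. Then there exists an affine map $f:\mathcal{O}_{\mathcal{S}}\to\mathcal{B}$ such that $f(x)\in\mathcal{C}(x)$ and $f(x)\neq 0$ for all $x\in\mathcal{O}_{\mathcal{S}}$.
   Context: Let $\mathcal{S}\subseteq\mathbb{R}^n$ be an $n$-dimensional simplex with vertices $v_0,v_1,\ldots,v_n$ and facets $\mathcal{F}_0,\ldots,\mathcal{F}_n$, where $\mathcal{F}_j$ is the facet not containing $v_j$; let $h_j$ be an outward pointing normal vector to $\mathcal{F}_j$. Let $A\in\mathbb{R}^{n\times n}$, $B\in\mathbb{R}^{n\times m}$, $a\in\mathbb{R}^n$ (data of the affine control system $\dot x=Ax+Bu+a$). Put $\mathcal{B}=\mathrm{Im}(B)$ (a linear subspace of $\mathbb{R}^n$), $\mathcal{O}=\{x\in\mathbb{R}^n : Ax+a\in\mathcal{B}\}$ and $\mathcal{O}_{\mathcal{S}}=\mathcal{S}\cap\mathcal{O}$ (a polytope; $\dim\mathcal{O}_{\mathcal{S}}$ is its dimension). For $x\in\mathcal{S}$, let $I(x)\subseteq\{0,1,\ldots,n\}$ be the minimal set of indices such that $x\in\mathrm{co}\{v_i : i\in I(x)\}$, where $\mathrm{co}$ denotes convex hull, and define $\mathcal{C}(x)=\{y\in\mathbb{R}^n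 : h_j\cdot y\le 0 \text{ for all } j\in\{1,\ldots,n\}\setminus I(x)\}$. The notation $(v_0,v_i]$ means the closed segment from $v_0$ to $v_i$ with the endpoint $v_0$ removed. *)

theory Defs
  imports "HOL-Analysis.Analysis"
begin

text \<open>A family \<open>v\<close> is only used on the indices \<open>0, \<dots>, n\<close>, where \<open>n\<close> is the dimension \<open>CARD('n)\<close>
  of the ambient space.\<close>

definition vertices_of_simplex :: "(nat \<Rightarrow> real^'n) \<Rightarrow> bool" where
  "vertices_of_simplex v \<longleftrightarrow>
     inj_on v {0..CARD('n)} \<and> \<not> affine_dependent (v ` {0..CARD('n)})"

definition simplex_hull :: "(nat \<Rightarrow> real^'n) \<Rightarrow> (real^'n) set" where
  "simplex_hull v = convex hull (v ` {0..CARD('n)})"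

definition opp_facet :: "(nat \<Rightarrow> real^'n) \<Rightarrow> nat \<Rightarrow> (real^'n) set" where
  "opp_facet v j = convex hull (v ` ({0..CARD('n)} - {j}))"

definition outward_normal :: "(real^'n) set \<Rightarrow> (real^'n) set \<Rightarrow> real^'n \<Rightarrow> bool" where
  "outward_normal S F h \<longleftrightarrow>
     h \<noteq> 0 \<and> (\<forall>x\<in>F. \<forall>y\<in>F. h \<bullet> (y - x) = 0) \<and> (\<forall>x\<in>F. \<forall>y\<in>S. h \<bullet> (y - x) \<le> 0)"

definition outward_normals :: "(nat \<Rightarrow> real^'n) \<Rightarrow> (nat \<Rightarrow> real^'n) \<Rightarrow> bool" where
  "outward_normals v h \<longleftrightarrow>
     (\<forall>j\<in>{0..CARD('n)}. outward_normal (simplex_hull v) (opp_facet v j) (h j))"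

definition ctrl_image :: "real^'m^'n \<Rightarrow> (real^'n) set" where
  "ctrl_image B = range (\<lambda>u. B *v u)"

definition equilibria :: "real^'n^'n \<Rightarrow> real^'m^'n \<Rightarrow> real^'n \<Rightarrow> (real^'n) set" where
  "equilibria A B a = {x. A *v x + a \<in> ctrl_image B}"

definition simplex_equilibria ::
  "(nat \<Rightarrow> real^'n) \<Rightarrow> real^'n^'n \<Rightarrow> real^'m^'n \<Rightarrow> real^'n \<Rightarrow> (real^'n) set" where
  "simplex_equilibria v A B a = simplex_hull v \<inter> equilibria A B a"

definition is_min_index_set :: "(nat \<Rightarrow> real^'n) \<Rightarrow> real^'n \<Rightarrow> nat set \<Rightarrow> bool" where
  "is_min_index_set v x I \<longleftrightarrow>
     I \<subseteq> {0..CARD('n)} \<and> x \<in> convex hull (v ` I) \<and>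
     (\<forall>J. J \<subset> I \<longrightarrow> x \<notin> convex hull (v ` J))"

definition min_index_set :: "(nat \<Rightarrow> real^'n) \<Rightarrow> real^'n \<Rightarrow> nat set" where
  "min_index_set v x = (THE I. is_min_index_set v x I)"

text \<open>The description is proper on the simplex:\<close>

lemma is_min_index_set_ex1:
  fixes v :: "nat \<Rightarrow> real^'n"
  assumes v: "vertices_of_simplex v" and x: "x \<in> simplex_hull v"
  shows "\<exists>!I. is_min_index_set v x I"
proof -
  let ?N = "{0..CARD('n)}"
  let ?P = "{I. I \<subseteq> ?N \<and> x \<in> convex hull (v ` I)}"
  have inter: "I \<inter> J \<in> ?P" if "I \<in> ?P" "J \<in> ?P" for I J
  proof -
    have sub: "I \<subseteq> ?N" "J \<subseteq> ?N" using that by auto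
    have "\<not> affine_dependent (v ` I \<union> v ` J)"
      using v affine_independent_subset[of "v ` ?N" "v ` I \<union> v ` J"] image_mono[OF sub(1), of v]
        image_mono[OF sub(2), of v]
      by (simp add: vertices_of_simplex_def)
    moreover have "v ` (I \<inter> J) = v ` I \<inter> v ` J"
      using v sub inj_on_image_Int[of v ?N I J] by (simp add: vertices_of_simplex_def)
    ultimately show ?thesis
      using that convex_hull_Int[of "v ` I" "v ` J"] by (simp add: le_infI1)
  qed
  have "finite ?P" by (rule finite_subset[of _ "Pow ?N"]) auto
  moreover have "?N \<in> ?P" using x unfolding simplex_hull_def by auto
  ultimately obtain I where I: "I \<in> ?P" "\<And>J. J \<in> ?P \<Longrightarrow> J \<subseteq> I \<Longrightarrow> I = J"
    using finite_has_minimal[of ?P] by (metis (no_types, lifting) empty_iff)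
  show ?thesis
  proof (rule ex1I[of _ I])
    show "is_min_index_set v x I"
      unfolding is_min_index_set_def using I by blast
  next
    fix J assume "is_min_index_set v x J"
    then have J: "J \<in> ?P" "\<And>K. K \<subset> J \<Longrightarrow> x \<notin> convex hull (v ` K)"
      unfolding is_min_index_set_def by auto
    have IJ: "I \<inter> J \<in> ?P" using inter I(1) J(1) by blast
    have "I \<inter> J = I" using I(2)[OF IJ] by blast
    moreover have "I \<inter> J = J" using J(2)[of "I \<inter> J"] IJ by blast
    ultimately show "J = I" by simp
  qed
qed

text \<open>The index \<open>0\<close> is deliberately left out of the constraints.\<close>

definition inv_cone ::
  "(nat \<Rightarrow> real^'n) \<Rightarrow> (nat \<Rightarrow> real^'n) \<Rightarrow> real^'n \<Rightarrow> (real^'n) set" where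
  "inv_cone v h x = {y. \<forall>j \<in> {1..CARD('n)} - min_index_set v x. h j \<bullet> y \<le> 0}"

definition half_open_segment :: "'a::real_vector \<Rightarrow> 'a \<Rightarrow> 'a set" where
  "half_open_segment p q = closed_segment p q - {p}"

definition affine_map_on :: "'a::real_vector set \<Rightarrow> ('a \<Rightarrow> 'b::real_vector) \<Rightarrow> bool" where
  "affine_map_on X f \<longleftrightarrow> (\<exists>L c. linear L \<and> (\<forall>x\<in>X. f x = L x + c))"

end

theory Submission
  imports Defs
begin

text \<open>
  The claim is about a plane section \<open>K\<close> of the simplex, with \<open>v\<^sub>0 \<notin> K\<close>, and a hyperplane
  \<open>W = {y. m \<bullet> y = 0}\<close> of admissible directions. Put \<open>w\<^sub>i = v\<^sub>i - v\<^sub>0\<close>. These edge vectors form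
  a basis, and every nonnegative combination of them lies in every cone \<open>C(x)\<close>, since
  \<open>h\<^sub>j \<bullet> w\<^sub>i \<le> 0\<close> for all \<open>i, j \<ge> 1\<close>.

  The hypothesis on the shape of \<open>K\<close> yields an edge \<open>(v\<^sub>0, v\<^sub>i]\<close> that misses \<open>K\<close>: if
  \<open>K\<close> met all these edges, in points \<open>o\<^sub>j\<close>, it would be their convex hull
  (\<open>section_meeting_all_edges\<close>). Given such an \<open>i\<close>, an affine map can be written down
  (\<open>nonvanishing_cone_field_missing_edge\<close>). If the numbers \<open>m \<bullet> w\<^sub>j\<close> do not all have the same strict
  sign, then \<open>W\<close> contains a nonzero nonnegative combination of edge vectors, and this constant
  works. Otherwise take \<open>m\<close> with all \<open>m \<bullet> w\<^sub>j\<close> positive and let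
  \<open>f x = (m \<bullet> (x - v\<^sub>0)) w\<^sub>i - (m \<bullet> w\<^sub>i) (x - v\<^sub>0)\<close>. Its values are orthogonal to \<open>m\<close>. On a facet
  through \<open>v\<^sub>0\<close> the second term is tangential and the first is a nonnegative multiple of an edge
  vector, so \<open>f\<close> respects the cones. It vanishes only on the line through \<open>v\<^sub>0\<close> and \<open>v\<^sub>i\<close>, which
  meets the simplex in \<open>v\<^sub>0\<close> and the edge that misses \<open>K\<close>.

  The argument is uniform in the dimension \<open>n\<close>, with hyperplane sections of an \<open>n\<close>-simplex in place
  of plane sections of a tetrahedron, and the lemmas are stated at this generality.
\<close>

section \<open>Coordinates in the edge basis at the vertex \<open>v\<^sub>0\<close>\<close>

text \<open>
  Affine independence stated for indexed families, so that coefficients can be attached to indices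
  rather than to points; injectivity is part of the notion, since a repeated point is a dependence.
\<close>

lemma affine_independent_family:
  fixes p :: "'i \<Rightarrow> 'a::real_vector"
  assumes "finite I"
  shows "inj_on p I \<and> \<not> affine_dependent (p ` I) \<longleftrightarrow>
    (\<forall>c. sum c I = 0 \<longrightarrow> (\<Sum>i\<in>I. c i *\<^sub>R p i) = 0 \<longrightarrow> (\<forall>i\<in>I. c i = 0))"
    (is "?L \<longleftrightarrow> ?R")
proof
  assume L: ?L
  show ?R
  proof (intro allI impI ballI)
    fix c :: "'i \<Rightarrow> real" and i
    assume c: "sum c I = 0" "(\<Sum>i\<in>I. c i *\<^sub>R p i) = 0" and i: "i \<in> I"
    define u where "u = c \<circ> inv_into I p"
    have u: "u (p k) = c k" if "k \<in> I" for k
      using L that by (simp add: u_def)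
    have "sum u (p ` I) = 0" "(\<Sum>x\<in>p ` I. u x *\<^sub>R x) = 0"
      using L c u by (simp_all add: sum.reindex)
    then have "\<forall>x\<in>p ` I. u x = 0"
      using L assms affine_dependent_explicit_finite[of "p ` I"] by auto
    then show "c i = 0" using u i by auto
  qed
next
  assume R: ?R
  have inj: "inj_on p I"
  proof (rule inj_onI, rule ccontr)
    fix i j assume ij: "i \<in> I" "j \<in> I" "p i = p j" "i \<noteq> j"
    define c where "c k = (if k = i then 1 else 0) - (if k = j then 1 else (0::real))" for k
    have "sum c I = 0"
      using ij assms by (simp add: c_def sum_subtractf)
    moreover have "(\<Sum>k\<in>I. c k *\<^sub>R p k) = 0"
      using ij assms by (simp add: c_def scaleR_diff_left sum_subtractf if_distrib[of "\<lambda>r. r *\<^sub>R _"] cong: if_cong)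
    ultimately have "c i = 0" using R ij by blast
    then show False using ij by (simp add: c_def)
  qed
  moreover have "\<not> affine_dependent (p ` I)"
  proof
    assume "affine_dependent (p ` I)"
    then obtain u where "sum u (p ` I) = 0" "(\<Sum>x\<in>p ` I. u x *\<^sub>R x) = 0"
      and nz: "\<exists>x\<in>p ` I. u x \<noteq> 0"
      using assms affine_dependent_explicit_finite[of "p ` I"] by auto
    then have "\<forall>i\<in>I. (u \<circ> p) i = 0"
      using R[rule_format, of "u \<circ> p"] inj by (simp add: sum.reindex)
    then show False using nz by auto
  qed
  ultimately show ?L by blast
qed

text \<open>
  A linear relation between the edge vectors becomes an affine one between the vertices once \<open>v 0\<close>
  gets the coefficient that makes the total weight zero.
\<close>

lemma simplex_edges_independent:
  fixes v :: "nat \<Rightarrow> real^'n"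
  assumes v: "vertices_of_simplex v"
    and c: "(\<Sum>i=1..CARD('n). c i *\<^sub>R (v i - v 0)) = 0" and i: "i \<in> {1..CARD('n)}"
  shows "c i = 0"
proof -
  define d where "d = c(0 := - (\<Sum>i=1..CARD('n). c i))"
  have split: "{0..CARD('n)} = insert 0 {1..CARD('n)}" by auto
  have "sum d {0..CARD('n)} = 0"
    unfolding split by (simp add: d_def)
  moreover have "(\<Sum>i\<in>{0..CARD('n)}. d i *\<^sub>R v i) = 0"
    using c unfolding split
    by (simp add: d_def scaleR_diff_right sum_subtractf scaleR_sum_left)
  ultimately have "d i = 0"
    using v i affine_independent_family[of "{0..CARD('n)}" v]
    unfolding vertices_of_simplex_def by auto
  then show ?thesis using i by (simp add: d_def)
qed

lemma simplex_hull_coordinates: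
  fixes v :: "nat \<Rightarrow> real^'n"
  assumes v: "vertices_of_simplex v" and x: "x \<in> simplex_hull v"
  obtains u where "\<And>i. i \<in> {1..CARD('n)} \<Longrightarrow> 0 \<le> u i" "(\<Sum>i=1..CARD('n). u i) \<le> 1"
    "x - v 0 = (\<Sum>i=1..CARD('n). u i *\<^sub>R (v i - v 0))"
proof -
  have split: "{0..CARD('n)} = insert 0 {1..CARD('n)}" by auto
  have inj: "inj_on v {0..CARD('n)}" using v by (simp add: vertices_of_simplex_def)
  obtain g where g: "\<forall>y\<in>v ` {0..CARD('n)}. 0 \<le> g y" "sum g (v ` {0..CARD('n)}) = 1"
     "(\<Sum>y\<in>v ` {0..CARD('n)}. g y *\<^sub>R y) = x"
    using x unfolding simplex_hull_def by (auto simp: convex_hull_finite)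
  define u where "u = g \<circ> v"
  have u0: "0 \<le> u i" if "i \<in> {0..CARD('n)}" for i
    using g(1) that by (simp add: u_def)
  have "sum u {0..CARD('n)} = 1" "(\<Sum>i\<in>{0..CARD('n)}. u i *\<^sub>R v i) = x"
    using g(2,3) by (simp_all add: sum.reindex[OF inj] u_def)
  then have u1: "u 0 + (\<Sum>i=1..CARD('n). u i) = 1"
    and ux: "u 0 *\<^sub>R v 0 + (\<Sum>i=1..CARD('n). u i *\<^sub>R v i) = x"
    unfolding split by simp_all
  have "(\<Sum>i=1..CARD('n). u i *\<^sub>R (v i - v 0))
      = (\<Sum>i=1..CARD('n). u i *\<^sub>R v i) - (\<Sum>i=1..CARD('n). u i) *\<^sub>R v 0"
    by (simp only: scaleR_diff_right sum_subtractf scaleR_sum_left)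
  also have "(\<Sum>i=1..CARD('n). u i) = 1 - u 0" using u1 by linarith
  also have "(\<Sum>i=1..CARD('n). u i *\<^sub>R v i) = x - u 0 *\<^sub>R v 0"
    unfolding ux[symmetric] by (rule add_diff_cancel_left'[symmetric])
  also have "x - u 0 *\<^sub>R v 0 - (1 - u 0) *\<^sub>R v 0 = x - v 0" by (simp add: algebra_simps)
  finally have "x - v 0 = (\<Sum>i=1..CARD('n). u i *\<^sub>R (v i - v 0))" by (rule sym)
  moreover have "(\<Sum>i=1..CARD('n). u i) \<le> 1" using u0[of 0] u1 by simp
  moreover have "0 \<le> u i" if "i \<in> {1..CARD('n)}" for i using u0 that by simp
  ultimately show ?thesis by (intro that)
qed

text \<open>
  By uniqueness of edge coordinates, \<open>s\<close> is the \<open>i\<close>-th coordinate of a point of the simplex and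
  so lies between \<open>0\<close> and \<open>1\<close>.
\<close>

lemma ray_in_simplex_half_open_segment:
  fixes v :: "nat \<Rightarrow> real^'n"
  assumes v: "vertices_of_simplex v" and i: "i \<in> {1..CARD('n)}"
    and x: "x \<in> simplex_hull v" "x \<noteq> v 0" "x - v 0 = s *\<^sub>R (v i - v 0)"
  shows "x \<in> half_open_segment (v 0) (v i)"
proof -
  obtain u where u: "\<And>i. i \<in> {1..CARD('n)} \<Longrightarrow> 0 \<le> u i" "(\<Sum>i=1..CARD('n). u i) \<le> 1"
    "x - v 0 = (\<Sum>i=1..CARD('n). u i *\<^sub>R (v i - v 0))"
    by (rule simplex_hull_coordinates[OF v x(1)]) (rule that)
  have "(\<Sum>k=1..CARD('n). (u k - (if k = i then s else 0)) *\<^sub>R (v k - v 0)) = 0"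
    using u(3) x(3) i
    by (simp add: scaleR_diff_left sum_subtractf if_distrib[of "\<lambda>r. r *\<^sub>R _"] cong: if_cong)
  then have "u i - (if i = i then s else 0) = 0"
    by (rule simplex_edges_independent[OF v _ i])
  then have "u i = s" by simp
  moreover have "u i \<le> (\<Sum>i=1..CARD('n). u i)"
    using u(1) i by (intro member_le_sum) auto
  ultimately have "0 \<le> s" "s \<le> 1" using u(1)[OF i] u(2) by auto
  moreover have "x = (1 - s) *\<^sub>R v 0 + s *\<^sub>R v i"
    using x(3) by (simp add: algebra_simps)
  ultimately have "x \<in> closed_segment (v 0) (v i)"
    unfolding closed_segment_def by blast
  then show ?thesis using x(2) by (simp add: half_open_segment_def)
qed

section \<open>Sections that meet every edge at \<open>v\<^sub>0\<close>\<close>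

text \<open>
  The points \<open>q i = v\<^sub>0 + t\<^sub>i w\<^sub>i\<close> with \<open>t\<^sub>i > 0\<close> are affinely independent, hence span the affine
  hull of \<open>K\<close> by equality of dimensions. So each \<open>x \<in> K\<close> is an affine combination of them; if
  \<open>c\<^sub>i\<close> is its \<open>i\<close>-th weight, then \<open>c\<^sub>i t\<^sub>i\<close> is the \<open>i\<close>-th edge coordinate of \<open>x\<close>, which is
  nonnegative in the simplex. The combination is therefore convex.
\<close>

lemma section_meeting_all_edges:
  fixes v q :: "nat \<Rightarrow> real^'n" and K :: "(real^'n) set"
  assumes v: "vertices_of_simplex v"
    and K: "convex K" "K \<subseteq> simplex_hull v" "aff_dim K = int CARD('n) - 1"
    and q: "\<And>i. i \<in> {1..CARD('n)} \<Longrightarrow> q i \<in> K \<inter> half_open_segment (v 0) (v i)"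
  shows "K = convex hull (q ` {1..CARD('n)})"
proof
  let ?I = "{1..CARD('n)}"
  have "\<exists>t. 0 < t \<and> q i = v 0 + t *\<^sub>R (v i - v 0)" if i: "i \<in> ?I" for i
  proof -
    obtain t where t: "0 \<le> t" "q i = (1 - t) *\<^sub>R v 0 + t *\<^sub>R v i" and "q i \<noteq> v 0"
      using q[OF i] by (auto simp: half_open_segment_def closed_segment_def)
    then have "t \<noteq> 0" by auto
    then show ?thesis using t by (intro exI[of _ t]) (simp add: algebra_simps)
  qed
  then obtain t where t: "\<And>i. i \<in> ?I \<Longrightarrow> 0 < t i"
    and qt: "\<And>i. i \<in> ?I \<Longrightarrow> q i = v 0 + t i *\<^sub>R (v i - v 0)" by metis
  have comb: "(\<Sum>i\<in>?I. c i *\<^sub>R q i) = sum c ?I *\<^sub>R v 0 + (\<Sum>i\<in>?I. (c i * t i) *\<^sub>R (v i - v 0))" for c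
  proof -
    have "(\<Sum>i\<in>?I. c i *\<^sub>R q i) = (\<Sum>i\<in>?I. c i *\<^sub>R v 0 + (c i * t i) *\<^sub>R (v i - v 0))"
      by (rule sum.cong) (simp_all add: qt scaleR_add_right)
    then show ?thesis by (simp add: sum.distrib scaleR_sum_left)
  qed
  have "inj_on q ?I \<and> \<not> affine_dependent (q ` ?I)"
    unfolding affine_independent_family[OF finite_atLeastAtMost]
  proof (intro allI impI ballI)
    fix c i assume c: "sum c ?I = 0" "(\<Sum>i\<in>?I. c i *\<^sub>R q i) = 0" and i: "i \<in> ?I"
    then have "c i * t i = 0"
      using comb[of c] by (intro simplex_edges_independent[OF v _ i]) simp
    then show "c i = 0" using t[OF i] by simp
  qed
  then have inj: "inj_on q ?I" and ind: "\<not> affine_dependent (q ` ?I)" by auto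
  have qK: "q ` ?I \<subseteq> K" using q by auto
  have "card (q ` ?I) = CARD('n)" using card_image[OF inj] by simp
  then have "aff_dim (q ` ?I) = aff_dim K"
    using aff_dim_affine_independent[OF ind] K(3) by linarith
  then have aff: "affine hull (q ` ?I) = affine hull K"
    using aff_dim_eq_full_gen[OF qK] by simp
  show "convex hull (q ` ?I) \<subseteq> K" using qK K(1) by (rule hull_minimal)
  show "K \<subseteq> convex hull (q ` ?I)"
  proof
    fix x assume x: "x \<in> K"
    then have "x \<in> affine hull (q ` ?I)" unfolding aff by (rule hull_inc)
    then obtain g where "sum g (q ` ?I) = 1" "(\<Sum>y\<in>q ` ?I. g y *\<^sub>R y) = x"
      by (auto simp: affine_hull_finite)
    then have c1: "sum (g \<circ> q) ?I = 1" and cx: "(\<Sum>i\<in>?I. (g \<circ> q) i *\<^sub>R q i) = x"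
      using inj by (simp_all add: sum.reindex)
    obtain u where u: "\<And>i. i \<in> ?I \<Longrightarrow> 0 \<le> u i" "sum u ?I \<le> 1"
      "x - v 0 = (\<Sum>i\<in>?I. u i *\<^sub>R (v i - v 0))"
      by (rule simplex_hull_coordinates[OF v subsetD[OF K(2) x]]) (rule that)
    have "x = v 0 + (\<Sum>i\<in>?I. ((g \<circ> q) i * t i) *\<^sub>R (v i - v 0))"
      using comb[of "g \<circ> q"] unfolding c1 cx scaleR_one .
    then have "x - v 0 = (\<Sum>i\<in>?I. ((g \<circ> q) i * t i) *\<^sub>R (v i - v 0))"
      by (rule trans[OF arg_cong[where f = "\<lambda>y. y - v 0"] add_diff_cancel_left'])
    then have diff0: "(\<Sum>i\<in>?I. ((g \<circ> q) i * t i - u i) *\<^sub>R (v i - v 0)) = 0"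
      using u(3) by (simp add: scaleR_diff_left sum_subtractf)
    have nonneg: "0 \<le> (g \<circ> q) i" if i: "i \<in> ?I" for i
    proof -
      have "(g \<circ> q) i * t i - u i = 0"
        by (rule simplex_edges_independent[OF v diff0 i])
      then have "0 \<le> (g \<circ> q) i * t i" using u(1)[OF i] by simp
      then show ?thesis using t[OF i] by (simp add: zero_le_mult_iff)
    qed
    have "(\<Sum>i\<in>?I. (g \<circ> q) i *\<^sub>R q i) \<in> convex hull (q ` ?I)"
      by (rule convex_sum) (use c1 nonneg in \<open>auto intro: hull_inc\<close>)
    then show "x \<in> convex hull (q ` ?I)" using cx by simp
  qed
qed

section \<open>Outward normals and edge vectors\<close>

lemma outward_normal_edge:
  fixes v h :: "nat \<Rightarrow> real^'n"
  assumes "outward_normals v h" "i \<in> {0..CARD('n)}" "j \<in> {1..CARD('n)}"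
  shows "h j \<bullet> (v i - v 0) \<le> 0"
proof -
  have "outward_normal (simplex_hull v) (opp_facet v j) (h j)"
    using assms(1,3) by (simp add: outward_normals_def)
  moreover have "v 0 \<in> opp_facet v j"
    unfolding opp_facet_def using assms(3) by (intro hull_inc) auto
  moreover have "v i \<in> simplex_hull v"
    unfolding simplex_hull_def using assms(2) by (intro hull_inc) auto
  ultimately show ?thesis unfolding outward_normal_def by blast
qed

lemma outward_normal_facet:
  fixes v h :: "nat \<Rightarrow> real^'n"
  assumes v: "vertices_of_simplex v" and h: "outward_normals v h" and x: "x \<in> simplex_hull v"
    and j: "j \<in> {1..CARD('n)} - min_index_set v x"
  shows "h j \<bullet> (x - v 0) = 0"
proof -
  have "is_min_index_set v x (min_index_set v x)"
    unfolding min_index_set_def by (rule theI'[OF is_min_index_set_ex1[OF v x]])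
  then have "min_index_set v x \<subseteq> {0..CARD('n)} - {j}" "x \<in> convex hull (v ` min_index_set v x)"
    using j by (auto simp: is_min_index_set_def)
  then have "x \<in> opp_facet v j"
    unfolding opp_facet_def by (meson hull_mono image_mono subsetD)
  moreover have "v 0 \<in> opp_facet v j"
    unfolding opp_facet_def using j by (intro hull_inc) auto
  moreover have "outward_normal (simplex_hull v) (opp_facet v j) (h j)"
    using h j by (simp add: outward_normals_def)
  ultimately show ?thesis unfolding outward_normal_def by blast
qed

section \<open>The affine map\<close>

lemma affine_map_on_const: "affine_map_on X (\<lambda>x. c)"
  unfolding affine_map_on_def by (intro exI[of _ "\<lambda>x. 0"] exI[of _ c]) (simp add: linear_zero)

text \<open>
  In the case of a constant, uniqueness of edge coordinates shows that it is nonzero. In the case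
  of the explicit \<open>f\<close>, its zeros in the simplex lie on the edge with index \<open>i\<close>, which is where the
  assumption that this edge misses \<open>K\<close> enters.
\<close>

lemma nonvanishing_cone_field_missing_edge:
  fixes v h :: "nat \<Rightarrow> real^'n" and K W :: "(real^'n) set"
  assumes v: "vertices_of_simplex v" and h: "outward_normals v h"
    and K: "K \<subseteq> simplex_hull v" "v 0 \<notin> K"
    and i: "i \<in> {1..CARD('n)}" "K \<inter> half_open_segment (v 0) (v i) = {}"
    and W: "subspace W" "dim W = CARD('n) - 1"
  shows "\<exists>f. affine_map_on K f \<and> (\<forall>x\<in>K. f x \<in> W \<and> f x \<in> inv_cone v h x \<and> f x \<noteq> 0)"
proof -
  define w where "w j = v j - v 0" for j
  have "span W = W" using W(1) by simp
  moreover have "dim W = DIM(real^'n) - 1" using W(2) by simp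
  ultimately obtain m0 where m0: "W = {y. m0 \<bullet> y = 0}"
    using dim_eq_hyperplane[of W] by metis
  \<comment> \<open>Orienting the normal by the sign on \<open>w i\<close> leaves three cases instead of symmetric pairs.\<close>
  define m where "m = (if m0 \<bullet> w i < 0 then - m0 else m0)"
  have Wm: "y \<in> W \<longleftrightarrow> m \<bullet> y = 0" for y by (simp add: m0 m_def)
  have mi: "0 \<le> m \<bullet> w i" by (simp add: m_def)
  have hw: "h k \<bullet> w j \<le> 0" if "j \<in> {1..CARD('n)}" "k \<in> {1..CARD('n)}" for j k
    using outward_normal_edge[OF h] that by (simp add: w_def)
  have wi: "w i \<noteq> 0"
    using v i(1) unfolding w_def vertices_of_simplex_def inj_on_def by fastforce
  consider "m \<bullet> w i = 0"
    | j where "0 < m \<bullet> w i" "j \<in> {1..CARD('n)}" "m \<bullet> w j \<le> 0"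
    | "0 < m \<bullet> w i" "\<And>j. j \<in> {1..CARD('n)} \<Longrightarrow> 0 < m \<bullet> w j"
    using mi by (metis not_le order_le_less)
  then show ?thesis
  proof cases
    case 1
    have "w i \<in> W" "w i \<in> inv_cone v h x" for x
      using 1 hw[OF i(1)] by (auto simp: Wm inv_cone_def)
    then show ?thesis using wi affine_map_on_const[of K "w i"] by blast
  next
    case (2 j)
    \<comment> \<open>The combination of \<open>w i\<close> and \<open>w j\<close> in \<open>W\<close>; both coefficients are nonnegative here.\<close>
    define b where "b = (m \<bullet> w i) *\<^sub>R w j - (m \<bullet> w j) *\<^sub>R w i"
    have ij: "i \<noteq> j" using 2 by auto
    have "b \<in> W" by (simp add: Wm b_def inner_diff_right)
    moreover have "b \<in> inv_cone v h x" for x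
    proof -
      have "h k \<bullet> b \<le> 0" if k: "k \<in> {1..CARD('n)}" for k
      proof -
        have "(m \<bullet> w i) * (h k \<bullet> w j) \<le> 0" 
          using 2 hw[OF 2(2) k] by (simp add: mult_nonneg_nonpos)
        moreover have "0 \<le> (m \<bullet> w j) * (h k \<bullet> w i)" 
          using 2 hw[OF i(1) k] by (simp add: mult_nonpos_nonpos)
        ultimately show ?thesis by (simp add: b_def inner_diff_right)
      qed
      then show ?thesis by (auto simp: inv_cone_def)
    qed
    moreover have "b \<noteq> 0"
    proof
      assume b0: "b = 0"
      define c where "c k = (if k = j then m \<bullet> w i else 0) - (if k = i then m \<bullet> w j else 0)" for k
      have "(\<Sum>k=1..CARD('n). c k *\<^sub>R (v k - v 0)) = b"
        using i(1) 2(2)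
        by (simp add: c_def b_def w_def scaleR_diff_left sum_subtractf
            if_distrib[of "\<lambda>r. r *\<^sub>R _"] cong: if_cong)
      then have "c j = 0" using b0 simplex_edges_independent[OF v _ 2(2)] by simp
      then show False using 2 ij by (simp add: c_def)
    qed
    ultimately show ?thesis using affine_map_on_const[of K b] by blast
  next
    case 3
    \<comment> \<open>Up to the positive factor \<open>m \<bullet> w i\<close>, this is the vector from \<open>x - v 0\<close> to its projection
      along \<open>W\<close> onto the line spanned by \<open>w i\<close>.\<close>
    define f where "f x = (m \<bullet> (x - v 0)) *\<^sub>R w i - (m \<bullet> w i) *\<^sub>R (x - v 0)" for x
    have "affine_map_on K f"
      unfolding affine_map_on_def
    proof (intro exI conjI ballI)
      show "linear (\<lambda>x. (m \<bullet> x) *\<^sub>R w i - (m \<bullet> w i) *\<^sub>R x)"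
        by (rule linearI) (simp_all add: inner_add_right algebra_simps)
      show "f x = (m \<bullet> x) *\<^sub>R w i - (m \<bullet> w i) *\<^sub>R x + f 0" for x
        by (simp add: f_def inner_diff_right algebra_simps)
    qed
    moreover have "f x \<in> W" for x by (simp add: Wm f_def inner_diff_right)
    moreover have "f x \<in> inv_cone v h x" if x: "x \<in> K" for x
    proof -
      obtain u where u: "\<And>i. i \<in> {1..CARD('n)} \<Longrightarrow> 0 \<le> u i"
        "(\<Sum>i=1..CARD('n). u i) \<le> 1" "x - v 0 = (\<Sum>i=1..CARD('n). u i *\<^sub>R (v i - v 0))"
        by (rule simplex_hull_coordinates[OF v subsetD[OF K(1) x]]) (rule that)
      have "m \<bullet> (x - v 0) = (\<Sum>i=1..CARD('n). u i * (m \<bullet> w i))"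
        by (simp only: u(3) inner_sum_right inner_scaleR_right w_def)
      also have "\<dots> \<ge> 0"
        by (rule sum_nonneg, rule mult_nonneg_nonneg) (use u(1) 3(2) in \<open>auto intro: less_imp_le\<close>)
      finally have mx: "0 \<le> m \<bullet> (x - v 0)" .
      show ?thesis
        unfolding inv_cone_def
      proof (intro CollectI ballI)
        fix j assume j: "j \<in> {1..CARD('n)} - min_index_set v x"
        have "h j \<bullet> (x - v 0) = 0"
          using outward_normal_facet[OF v h _ j] K(1) x by blast
        then have "h j \<bullet> f x = (m \<bullet> (x - v 0)) * (h j \<bullet> w i)"
          by (simp only: f_def inner_diff_right[of "h j" "_ *\<^sub>R _"] inner_scaleR_right)
        then show "h j \<bullet> f x \<le> 0" using mx hw[OF i(1)] j by (simp add: mult_nonneg_nonpos)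
      qed
    qed
    moreover have "f x \<noteq> 0" if x: "x \<in> K" for x
    proof
      assume "f x = 0"
      then have zero: "(m \<bullet> w i) *\<^sub>R (x - v 0) = (m \<bullet> (x - v 0)) *\<^sub>R w i" by (simp add: f_def)
      have "x - v 0 = inverse (m \<bullet> w i) *\<^sub>R ((m \<bullet> w i) *\<^sub>R (x - v 0))" using 3(1) by simp
      also have "\<dots> = (inverse (m \<bullet> w i) * (m \<bullet> (x - v 0))) *\<^sub>R (v i - v 0)"
        unfolding zero by (simp add: w_def)
      finally have "x - v 0 = (inverse (m \<bullet> w i) * (m \<bullet> (x - v 0))) *\<^sub>R (v i - v 0)" .
      then have "x \<in> half_open_segment (v 0) (v i)"
        using ray_in_simplex_half_open_segment[OF v i(1)] K x by blast
      then show False using i(2) x by blast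
    qed
    ultimately show ?thesis by blast
  qed
qed

lemma subspace_ctrl_image: "subspace (ctrl_image B)"
  unfolding ctrl_image_def by (intro linear_subspace_image subspace_UNIV) simp

lemma convex_simplex_equilibria: "convex (simplex_equilibria v A B a)"
proof -
  have "convex (equilibria A B a)"
  proof (rule convexI)
    fix x y and s t :: real
    assume xy: "x \<in> equilibria A B a" "y \<in> equilibria A B a" and st: "s + t = 1"
    have "A *v (s *\<^sub>R x + t *\<^sub>R y) + a = s *\<^sub>R (A *v x) + t *\<^sub>R (A *v y) + (s + t) *\<^sub>R a"
      using st by (simp add: matrix_vector_right_distrib matrix_vector_mult_scaleR)
    also have "\<dots> = s *\<^sub>R (A *v x + a) + t *\<^sub>R (A *v y + a)"
      by (simp add: algebra_simps)
    also have "\<dots> \<in> ctrl_image B"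
      using xy subspace_ctrl_image[of B]
      by (simp add: equilibria_def subspace_add subspace_scale)
    finally show "s *\<^sub>R x + t *\<^sub>R y \<in> equilibria A B a" by (simp add: equilibria_def)
  qed
  then show ?thesis
    by (simp add: simplex_equilibria_def simplex_hull_def convex_Int)
qed

theorem theorem16:
  fixes v h :: "nat \<Rightarrow> real^3"
    and A :: "real^3^3" and B :: "real^'m^3" and a :: "real^3"
  assumes "vertices_of_simplex v"
    and "outward_normals v h"
    and "aff_dim (simplex_equilibria v A B a) = 2"
    and "dim (ctrl_image B) = 2"
    and "v 0 \<notin> simplex_equilibria v A B a"
    and "\<not> (\<exists>o1 o2 o3. o1 \<in> half_open_segment (v 0) (v 1) \<and>
               o2 \<in> half_open_segment (v 0) (v 2) \<and>
               o3 \<in> half_open_segment (v 0) (v 3) \<and>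
               simplex_equilibria v A B a = convex hull {o1, o2, o3})"
  shows "\<exists>f :: real^3 \<Rightarrow> real^3.
           affine_map_on (simplex_equilibria v A B a) f \<and>
           (\<forall>x \<in> simplex_equilibria v A B a.
              f x \<in> ctrl_image B \<and> f x \<in> inv_cone v h x \<and> f x \<noteq> 0)"
proof -
  let ?K = "simplex_equilibria v A B a"
  have K: "?K \<subseteq> simplex_hull v" by (simp add: simplex_equilibria_def)
  have I: "{1..CARD(3)} = {1, 2, 3}" by auto
  have "\<exists>i\<in>{1..CARD(3)}. ?K \<inter> half_open_segment (v 0) (v i) = {}"
  proof (rule ccontr)
    assume "\<not> ?thesis"
    then have "\<forall>i\<in>{1..CARD(3)}. \<exists>y. y \<in> ?K \<inter> half_open_segment (v 0) (v i)" by blast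
    then obtain q where q: "\<And>i. i \<in> {1..CARD(3)} \<Longrightarrow> q i \<in> ?K \<inter> half_open_segment (v 0) (v i)"
      by metis
    have "?K = convex hull (q ` {1..CARD(3)})"
      using assms(1) convex_simplex_equilibria K _ q
      by (rule section_meeting_all_edges) (simp add: assms(3))
    then have "?K = convex hull {q 1, q 2, q 3}" unfolding I by simp
    then show False using assms(6) q unfolding I by blast
  qed
  then obtain i where "i \<in> {1..CARD(3)}" "?K \<inter> half_open_segment (v 0) (v i) = {}" by blast
  then show ?thesis
    using assms(4)
    by (intro nonvanishing_cone_field_missing_edge[OF assms(1,2) K assms(5)] subspace_ctrl_image) auto
qed

end
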